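(* Let $r \in \mathbb{N}$ and let $a_1, a_2, \ldots, a_r \in \mathbb{N}$. Then the complete $r$-partite graph $\mathcal{K}(a_1,\ldots,a_r)$ is $\mathcal{D}$-unique if and only if for all $1 \le i < j \le r$, either $\max\{a_i,a_j\} \le 2$ or $|a_i - a_j| \ge 2$.
   Context: All graphs are finite and simple, and $\mathbb{N}$ denotes the positive integers. For a graph $G=(V,E)$, $v(G)=|V|$, and $N[v]$ denotes the closed neighborhood of a vertex $v$ (i.e. $v$ together with all its neighbors). A set $S \subseteq V$ is a dominating set of $G$ if $\bigcup_{x\in S} N[x] = V$. Let $d(G,i)$ be the number of dominating sets of $G$ of cardinality $i$. The domination polynomial of $G$ is $D(G,x)=\sum_{i=1}^{v(G)} d(G,i)\, x^i$. A graph $G$ is called $\mathcal{D}$-unique if for every graph $H$, $D(H,x)=D(G,x)$ implies $H \cong G$. For $r \in \mathbb{N}$ and $a_1,\ldots,a_r\in\mathbb{N}$, $\mathcal{K}(a_1,\ldots,a_r)$ denotes the complete $r$-partite graph on $a_1+\cdots+a_r$ vertices with color classes of sizes $a_1,\ldots,a_r$ (two vertices are adjacent if and only if they lie in different color classes); for $r=1$, $\mathcal{K}(a)$ is the graph on $a$ vertices with no edges. *)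

theory Defs
  imports
    "Graph_Theory.Pair_Digraph"
    "Graph_Theory.Digraph_Isomorphism"
    "HOL-Computational_Algebra.Polynomial"
begin

text \<open>
  A finite simple graph is a \<^locale>\<open>pair_graph\<close>: a finite loopless digraph whose arcs are pairs of
  vertices and whose arc relation is symmetric, so an edge between \<open>u\<close> and \<open>v\<close> is the pair of
  arcs \<open>(u, v)\<close>, \<open>(v, u)\<close>.
\<close>

definition closed_nbhd :: "'a pair_pre_digraph \<Rightarrow> 'a \<Rightarrow> 'a set" where
  "closed_nbhd G v = insert v {u. (v, u) \<in> parcs G}"

definition dominating_set :: "'a pair_pre_digraph \<Rightarrow> 'a set \<Rightarrow> bool" where
  "dominating_set G S \<longleftrightarrow> S \<subseteq> pverts G \<and> (\<Union>x\<in>S. closed_nbhd G x) = pverts G"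

definition dom_count :: "'a pair_pre_digraph \<Rightarrow> nat \<Rightarrow> nat" where
  "dom_count G i = card {S. dominating_set G S \<and> card S = i}"

definition domination_poly :: "'a pair_pre_digraph \<Rightarrow> int poly" where
  "domination_poly G = (\<Sum>i = 1..card (pverts G). monom (int (dom_count G i)) i)"

text \<open>
  A definition cannot quantify over the vertex type of \<open>H\<close>. Every finite graph has an isomorphic
  copy with vertices in \<^typ>\<open>nat\<close>, so ranging over those loses nothing; \<open>D_unique_iff\<close> below
  replaces \<^typ>\<open>nat\<close> by any infinite vertex type, and \<open>D_uniqueD\<close> gives uniqueness among
  graphs on an arbitrary vertex type.
\<close>

definition D_unique :: "'a pair_pre_digraph \<Rightarrow> bool" where
  "D_unique G \<longleftrightarrow>
    (\<forall>H :: nat pair_pre_digraph. pair_graph H \<longrightarrow> domination_poly H = domination_poly G \<longrightarrow>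
       digraph_iso (with_proj H) (with_proj G))"

text \<open>The vertex \<open>(i, k)\<close> is the \<open>k\<close>-th vertex of the \<open>i\<close>-th color class.\<close>

definition complete_multipartite :: "nat \<Rightarrow> (nat \<Rightarrow> nat) \<Rightarrow> (nat \<times> nat) pair_pre_digraph" where
  "complete_multipartite r a =
    (let V = (SIGMA i:{1..r}. {1..a i})
     in \<lparr> pverts = V, parcs = {(u, v). u \<in> V \<and> v \<in> V \<and> fst u \<noteq> fst v} \<rparr>)"

lemma pair_graph_complete_multipartite: "pair_graph (complete_multipartite r a)"
proof -
  let ?V = "SIGMA i:{1..r}. {1..a i}"
  have "finite {(u, v). u \<in> ?V \<and> v \<in> ?V \<and> fst u \<noteq> fst v}"
    by (rule finite_subset[of _ "?V \<times> ?V"]) auto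
  then show ?thesis
    by unfold_locales
      (auto simp: complete_multipartite_def Let_def symmetric_def arcs_ends_conv sym_def with_proj_def image_iff)
qed

lemma digraph_iso_pair_iff:
  assumes "pair_wf_digraph G"
  shows "digraph_iso (with_proj G) (with_proj H) \<longleftrightarrow>
    (\<exists>f. bij_betw f (pverts G) (pverts H) \<and> parcs H = map_prod f f ` parcs G)"
proof
  assume "digraph_iso (with_proj G) (with_proj H)"
  then obtain h where h: "pre_digraph.digraph_isomorphism (with_proj G) h"
    and H: "with_proj H = app_iso h (with_proj G)"
    unfolding digraph_iso_def by blast
  have H': "pverts H = iso_verts h ` pverts G" "parcs H = iso_arcs h ` parcs G"
    "iso_tail h = fst" "iso_head h = snd"
    using H by (simp_all add: with_proj_def app_iso_def)
  have arc: "iso_arcs h e = map_prod (iso_verts h) (iso_verts h) e" if "e \<in> parcs G" for e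
    using h that H' unfolding pre_digraph.digraph_isomorphism_def
    by (auto simp: with_proj_def prod_eq_iff)
  have "parcs H = map_prod (iso_verts h) (iso_verts h) ` parcs G"
    using arc H'(2) by (auto simp: image_iff)
  moreover have "bij_betw (iso_verts h) (pverts G) (pverts H)"
    using h H'(1) unfolding pre_digraph.digraph_isomorphism_def bij_betw_def
    by (simp add: with_proj_def)
  ultimately show "\<exists>f. bij_betw f (pverts G) (pverts H) \<and> parcs H = map_prod f f ` parcs G"
    by blast
next
  assume "\<exists>f. bij_betw f (pverts G) (pverts H) \<and> parcs H = map_prod f f ` parcs G"
  then obtain f where f: "inj_on f (pverts G)" "pverts H = f ` pverts G"
      "parcs H = map_prod f f ` parcs G"
    by (auto simp: bij_betw_def)
  interpret pair_wf_digraph G by fact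
  let ?h = "\<lparr> iso_verts = f, iso_arcs = map_prod f f, iso_head = snd, iso_tail = fst \<rparr>"
  have "inj_on (map_prod f f) (parcs G)"
    by (intro inj_on_subset[OF map_prod_inj_on[OF f(1) f(1)]] subsetI)
      (simp add: mem_Times_iff arc_fst_in_verts arc_snd_in_verts)
  then have "pre_digraph.digraph_isomorphism (with_proj G) ?h"
    using f wf_digraph_wp_iff[of G] assms
    unfolding pre_digraph.digraph_isomorphism_def by (auto simp: with_proj_def)
  moreover have "with_proj H = app_iso ?h (with_proj G)"
    using f by (simp add: with_proj_def app_iso_def)
  ultimately show "digraph_iso (with_proj G) (with_proj H)"
    unfolding digraph_iso_def by blast
qed

lemma domination_poly_iso:
  assumes "pair_wf_digraph G" "digraph_iso (with_proj G) (with_proj H)"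
  shows "domination_poly G = domination_poly H"
proof -
  obtain f where f: "bij_betw f (pverts G) (pverts H)" "parcs H = map_prod f f ` parcs G"
    using assms(2) unfolding digraph_iso_pair_iff[OF assms(1)] by blast
  interpret pair_wf_digraph G by fact
  have inj: "inj_on f (pverts G)" and img: "pverts H = f ` pverts G"
    using f by (auto simp: bij_betw_def)
  have arcs: "u \<in> pverts G" "v \<in> pverts G" if "(u, v) \<in> parcs G" for u v
    using arc_fst_in_verts[OF that] arc_snd_in_verts[OF that] by auto
  have sub: "closed_nbhd G x \<subseteq> pverts G" if "x \<in> pverts G" for x
    using that arcs by (auto simp: closed_nbhd_def)
  have nb: "closed_nbhd H (f x) = f ` closed_nbhd G x" if "x \<in> pverts G" for x
  proof (intro set_eqI iffI)
    fix y assume "y \<in> closed_nbhd H (f x)"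
    then consider "y = f x" | u v where "(u, v) \<in> parcs G" "f x = f u" "y = f v"
      unfolding closed_nbhd_def f(2) by auto
    then show "y \<in> f ` closed_nbhd G x"
    proof cases
      case (2 u v)
      then have "u = x"
        using inj_onD[OF inj, of x u] that arcs(1) by simp
      with 2 show ?thesis
        by (simp add: closed_nbhd_def)
    qed (simp add: closed_nbhd_def)
  next
    fix y assume "y \<in> f ` closed_nbhd G x"
    then show "y \<in> closed_nbhd H (f x)"
      unfolding closed_nbhd_def f(2) by force
  qed
  have dom: "dominating_set H (f ` S) \<longleftrightarrow> dominating_set G S" if S: "S \<subseteq> pverts G" for S
  proof -
    have "(\<Union>y\<in>f ` S. closed_nbhd H y) = (\<Union>x\<in>S. closed_nbhd H (f x))"
      by blast
    also have "\<dots> = (\<Union>x\<in>S. f ` closed_nbhd G x)"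
      using S nb by (intro SUP_cong) auto
    also have "\<dots> = f ` (\<Union>x\<in>S. closed_nbhd G x)"
      by blast
    finally have 1: "(\<Union>y\<in>f ` S. closed_nbhd H y) = f ` (\<Union>x\<in>S. closed_nbhd G x)" .
    have 2: "(\<Union>x\<in>S. closed_nbhd G x) \<subseteq> pverts G"
      using S sub by blast
    show ?thesis
      unfolding dominating_set_def 1 img
      using S inj_on_image_eq_iff[OF inj 2 subset_refl] by (simp add: image_mono)
  qed
  have cnt: "dom_count G i = dom_count H i" for i
    unfolding dom_count_def
  proof (rule bij_betw_same_card)
    show "bij_betw ((`) f) {S. dominating_set G S \<and> card S = i} {S. dominating_set H S \<and> card S = i}"
      unfolding bij_betw_def
    proof (intro conjI set_eqI iffI)
      show "inj_on ((`) f) {S. dominating_set G S \<and> card S = i}"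
        by (rule inj_on_subset[OF inj_on_image_Pow[OF inj]]) (simp add: dominating_set_def subset_iff)
    next
      fix T assume "T \<in> (`) f ` {S. dominating_set G S \<and> card S = i}"
      then obtain S where S: "T = f ` S" "dominating_set G S" "card S = i"
        by blast
      then have sub: "S \<subseteq> pverts G"
        by (simp add: dominating_set_def)
      show "T \<in> {S. dominating_set H S \<and> card S = i}"
        using S dom[OF sub] card_image[OF inj_on_subset[OF inj sub]] by simp
    next
      fix T assume T: "T \<in> {S. dominating_set H S \<and> card S = i}"
      then have "T \<subseteq> f ` pverts G"
        by (simp add: dominating_set_def img)
      then obtain S where S: "S \<subseteq> pverts G" "T = f ` S"
        by (auto simp: subset_image_iff)
      have "S \<in> {S. dominating_set G S \<and> card S = i}"
        using T dom[OF S(1)] card_image[OF inj_on_subset[OF inj S(1)]] S(2) by simp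
      then show "T \<in> (`) f ` {S. dominating_set G S \<and> card S = i}"
        using S(2) by (rule rev_image_eqI)
    qed
  qed
  show ?thesis
    unfolding domination_poly_def cnt bij_betw_same_card[OF f(1)] ..
qed

lemma digraph_iso_pair_trans:
  assumes "pair_wf_digraph G" "pair_wf_digraph H"
    and "digraph_iso (with_proj G) (with_proj H)" "digraph_iso (with_proj H) (with_proj K)"
  shows "digraph_iso (with_proj G) (with_proj K)"
proof -
  obtain f g where "bij_betw f (pverts G) (pverts H)" "parcs H = map_prod f f ` parcs G"
    "bij_betw g (pverts H) (pverts K)" "parcs K = map_prod g g ` parcs H"
    using assms(3,4) unfolding digraph_iso_pair_iff[OF assms(1)] digraph_iso_pair_iff[OF assms(2)]
    by blast
  then have "bij_betw (g \<circ> f) (pverts G) (pverts K)"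
      "parcs K = map_prod (g \<circ> f) (g \<circ> f) ` parcs G"
    by (auto intro: bij_betw_trans simp: image_comp map_prod.comp)
  then show ?thesis
    using digraph_iso_pair_iff[OF assms(1)] by blast
qed

lemma ex_iso_copy:
  fixes H :: "'b pair_pre_digraph"
  assumes "pair_graph H" and "infinite (UNIV :: 'c set)"
  shows "\<exists>H' :: 'c pair_pre_digraph. pair_graph H' \<and> digraph_iso (with_proj H) (with_proj H')"
proof -
  interpret pair_graph H by fact
  obtain W :: "'c set" where W: "finite W" "card W = card (pverts H)"
    using infinite_arbitrarily_large[OF assms(2)] by blast
  then obtain f where f: "bij_betw f (pverts H) W"
    using finite_same_card_bij[OF pair_finite_verts W(1)] by auto
  let ?H' = "\<lparr> pverts = W, parcs = map_prod f f ` parcs H \<rparr>"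
  have fW: "f x \<in> W" if "x \<in> pverts H" for x
    using f that by (auto simp: bij_betw_def)
  have arcs: "u \<in> pverts H" "v \<in> pverts H" "u \<noteq> v" if "(u, v) \<in> parcs H" for u v
    using arc_fst_in_verts[OF that] arc_snd_in_verts[OF that] pair_no_loops[OF that] by auto
  have ne: "f u \<noteq> f v" if "(u, v) \<in> parcs H" for u v
    using arcs[OF that] f by (auto simp: bij_betw_def inj_on_def)
  have sym: "sym (parcs H)"
    using pair_sym_arcs by (simp add: symmetric_def)
  have sym': "sym (map_prod f f ` parcs H)"
    using sym by (fastforce simp: sym_def)
  have "pair_graph ?H'"
    using W(1) pair_finite_arcs arcs fW ne sym'
    by unfold_locales (auto simp: symmetric_def arcs_ends_conv with_proj_def)
  moreover have "digraph_iso (with_proj H) (with_proj ?H')"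
    using f digraph_iso_pair_iff[OF pair_wf_digraph, of ?H'] by auto
  ultimately show ?thesis by blast
qed

lemma D_uniqueD:
  fixes H :: "'b pair_pre_digraph"
  assumes "D_unique G" "pair_graph H" "domination_poly H = domination_poly G"
  shows "digraph_iso (with_proj H) (with_proj G)"
proof -
  obtain H' :: "nat pair_pre_digraph" where
    H': "pair_graph H'" "digraph_iso (with_proj H) (with_proj H')"
    using ex_iso_copy[OF assms(2)] by blast
  interpret H: pair_graph H by fact
  interpret H': pair_graph H' by fact
  have "domination_poly H' = domination_poly G"
    using assms(3) domination_poly_iso[OF H.pair_wf_digraph H'(2)] by simp
  with assms(1) H'(1) have "digraph_iso (with_proj H') (with_proj G)"
    by (simp add: D_unique_def)
  with H' show ?thesis
    using digraph_iso_pair_trans[OF H.pair_wf_digraph H'.pair_wf_digraph] by blast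
qed

lemma D_unique_iff:
  assumes "infinite (UNIV :: 'b set)"
  shows "D_unique G \<longleftrightarrow>
    (\<forall>H :: 'b pair_pre_digraph. pair_graph H \<longrightarrow> domination_poly H = domination_poly G \<longrightarrow>
       digraph_iso (with_proj H) (with_proj G))" (is "_ \<longleftrightarrow> ?R")
proof
  assume R: ?R
  show "D_unique G"
    unfolding D_unique_def
  proof (intro allI impI)
    fix H :: "nat pair_pre_digraph"
    assume H: "pair_graph H" "domination_poly H = domination_poly G"
    obtain H' :: "'b pair_pre_digraph" where
      H': "pair_graph H'" "digraph_iso (with_proj H) (with_proj H')"
      using ex_iso_copy[OF H(1) assms] by blast
    interpret H: pair_graph H by fact
    interpret H': pair_graph H' by fact
    have "domination_poly H' = domination_poly G"
      using H(2) domination_poly_iso[OF H.pair_wf_digraph H'(2)] by simp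
    with R H'(1) have "digraph_iso (with_proj H') (with_proj G)"
      by simp
    with H' show "digraph_iso (with_proj H) (with_proj G)"
      using digraph_iso_pair_trans[OF H.pair_wf_digraph H'.pair_wf_digraph] by blast
  qed
qed (use D_uniqueD in blast)

end

theory Submission
  imports Defs
begin

text \<open>
  Let \<open>F\<close> be the complement of \<open>G\<close>. A vertex set fails to dominate \<open>G\<close> iff it has a common neighbor in
  \<open>F\<close>, so the domination polynomial records the number of vertices and, for each \<open>k \<ge> 1\<close>, the number
  \<open>f\<^sub>k\<close> of \<open>k\<close>-sets with a common neighbor in \<open>F\<close>. For a complete multipartite graph, \<open>F\<close> is a disjoint
  union of cliques.

  Suppose the gap condition holds and let \<open>m\<close> be the largest class size. If \<open>m \<ge> 3\<close>, then \<open>f\<^sub>k\<close> is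
  \<open>0\<close>, \<open>m\<close>, \<open>m choose 2\<close> for \<open>k = m\<close>, \<open>m - 1\<close>, \<open>m - 2\<close>. By the equality case of Kruskal--Katona the \<open>m\<close>
  neighborhoods of size \<open>m - 1\<close> are the facets of a simplex on a set \<open>W\<close>, and \<open>W\<close> must be a clique
  component of \<open>F\<close>, which can be split off; \<open>m \<le> 2\<close> is immediate. Conversely, two classes whose sizes
  differ by at most one, the larger being at least 3, can be replaced in \<open>F\<close> by a bipartite graph with
  the same counts \<open>f\<^sub>k\<close> in which adjacency is not transitive.
\<close>

section \<open>Families of sets with a small shadow\<close>

definition shadow :: "nat \<Rightarrow> 'a set set \<Rightarrow> 'a set set" where
  "shadow n F = {T. card T = n \<and> (\<exists>S\<in>F. T \<subseteq> S)}"

lemma finite_shadow: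
  assumes "finite F" "\<And>S. S \<in> F \<Longrightarrow> finite S"
  shows "finite (shadow n F)"
proof (rule finite_subset)
  show "shadow n F \<subseteq> Pow (\<Union>F)" by (auto simp: shadow_def)
qed (use assms in auto)

lemma shadow_insert: "shadow n (insert S F) = shadow n {S} \<union> shadow n F"
  by (auto simp: shadow_def)

lemma card_shadow_singleton:
  assumes "card S = Suc n"
  shows "card (shadow n {S}) = Suc n"
proof -
  have "finite S" using assms card.infinite by fastforce
  moreover have "shadow n {S} = {T. T \<subseteq> S \<and> card T = n}"
    by (auto simp: shadow_def)
  ultimately show ?thesis
    using n_subsets[of S n] assms by (simp add: binomial_Suc_n)
qed

text \<open>Two distinct sets of size \<open>n + 1\<close> share at most one subset of size
  \<open>n\<close>, namely their intersection. So \<open>S\<close> loses at most one shadow set to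
  each member of \<open>F\<close>.\<close>

lemma shadow_Int_subset:
  assumes "card S = Suc n" "\<And>S'. S' \<in> F \<Longrightarrow> card S' = Suc n" "S \<notin> F"
  shows "shadow n {S} \<inter> shadow n F \<subseteq> (\<inter>) S ` F \<inter> {T. card T = n}"
proof
  fix T assume "T \<in> shadow n {S} \<inter> shadow n F"
  then obtain S' where T: "card T = n" "T \<subseteq> S" "S' \<in> F" "T \<subseteq> S'"
    by (auto simp: shadow_def)
  have fin: "finite S" "finite S'"
    using assms(1) assms(2)[OF T(3)] card.infinite by fastforce+
  have "S \<inter> S' \<noteq> S"
    using card_subset_eq[OF fin(2), of S] assms(1,3) assms(2)[OF T(3)] T(3) by auto
  then have "card (S \<inter> S') < Suc n"
    using psubset_card_mono[OF fin(1), of "S \<inter> S'"] assms(1) by auto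
  moreover have "T \<subseteq> S \<inter> S'" using T by blast
  ultimately have "T = S \<inter> S'"
    using card_seteq[of "S \<inter> S'" T] fin T(1) by auto
  then show "T \<in> (\<inter>) S ` F \<inter> {T. card T = n}" using T by auto
qed

lemma card_shadow_insert:
  assumes "finite F" "\<And>S'. S' \<in> insert S F \<Longrightarrow> card S' = Suc n"
  shows "card (shadow n (insert S F)) + card (shadow n {S} \<inter> shadow n F)
    = Suc n + card (shadow n F)"
proof -
  have fin: "finite S'" if "S' \<in> insert S F" for S'
    using assms(2)[OF that] card.infinite by fastforce
  show ?thesis
    using card_Un_Int[of "shadow n {S}" "shadow n F"] finite_shadow[of "{S}" n] finite_shadow[OF assms(1), of n]
      card_shadow_singleton[of S n] assms(2) fin
    by (simp add: shadow_insert[of n S F])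
qed

text \<open>When the sets of \<open>F - F0\<close> are added one by one, a set preceded by
  \<open>i\<close> others brings at least \<open>Suc n - i\<close> new shadow sets. Starting from an
  arbitrary \<open>F0\<close> lets an upper bound for the whole shadow be carried back to a
  subfamily.\<close>

lemma card_shadow_mono:
  assumes "finite F" "F0 \<subseteq> F" "\<And>S. S \<in> F \<Longrightarrow> card S = Suc n"
  shows "card (shadow n F0) + (\<Sum>i<card F. Suc n - i) \<le> card (shadow n F) + (\<Sum>i<card F0. Suc n - i)"
proof -
  have "finite F0" using assms finite_subset by blast
  have "finite G \<Longrightarrow> G \<inter> F0 = {} \<Longrightarrow> G \<subseteq> F \<Longrightarrow>
    card (shadow n F0) + (\<Sum>i<card (G \<union> F0). Suc n - i)
      \<le> card (shadow n (G \<union> F0)) + (\<Sum>i<card F0. Suc n - i)" for G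
  proof (induction G rule: finite_induct)
    case (insert S G)
    let ?G = "G \<union> F0"
    have fin: "finite ?G" using insert \<open>finite F0\<close> by simp
    have new: "S \<notin> ?G" using insert by auto
    have card: "\<And>S'. S' \<in> insert S ?G \<Longrightarrow> card S' = Suc n"
      using insert.prems assms(2,3) by blast
    have "card (shadow n {S} \<inter> shadow n ?G) \<le> card ((\<inter>) S ` ?G)"
      using shadow_Int_subset[of S n ?G] card new fin by (intro card_mono) blast+
    also have "\<dots> \<le> card ?G" using fin by (rule card_image_le)
    finally have "card (shadow n {S} \<inter> shadow n ?G) \<le> card ?G" .
    moreover have "card (shadow n (insert S ?G)) + card (shadow n {S} \<inter> shadow n ?G)
        = Suc n + card (shadow n ?G)"
      using card by (rule card_shadow_insert[OF fin])
    \<comment> \<open>This bound covers \<open>card ?G > Suc n\<close>, where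
      \<open>Suc n - card ?G\<close> is truncated to 0.\<close>
    moreover have "card (shadow n {S} \<inter> shadow n ?G) \<le> Suc n"
    proof -
      have c: "card (shadow n {S}) = Suc n" using card by (intro card_shadow_singleton) blast
      then have "finite (shadow n {S})" by (intro card_ge_0_finite) simp
      then show ?thesis unfolding c[symmetric] by (intro card_mono) blast+
    qed
    ultimately have "card (shadow n ?G) + (Suc n - card ?G) \<le> card (shadow n (insert S ?G))"
      by linarith
    then show ?case using insert new fin by simp
  qed simp
  moreover have "F - F0 \<union> F0 = F" using assms(2) by blast
  ultimately show ?thesis
    using assms(1) by (metis Diff_disjoint Diff_subset Int_commute finite_Diff)
qed

text \<open>The terms are \<open>n + 1\<close>, ..., \<open>1\<close>, \<open>0\<close>, so the sum
  is a triangular number. It turns the shadow bound for \<open>n + 2\<close> sets into an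
  equality.\<close>

lemma sum_diff_eq_choose: "(\<Sum>i<n + 2. Suc n - i) = (n + 2) choose n"
proof -
  have "(\<Sum>i<n + 2. Suc n - i) = (\<Sum>i<n + 2. i)"
    using sum.nat_diff_reindex[of "\<lambda>i. i" "n + 2"] by simp
  also have "\<dots> = (n + 2) choose 2"
    using gauss_sum_nat[of "Suc n"]
    by (simp add: choose_two lessThan_Suc_atMost atMost_atLeast0 del: sum.lessThan_Suc sum.atMost_Suc)
  also have "\<dots> = (n + 2) choose n"
    using binomial_symmetric[of 2 "n + 2"] by simp
  finally show ?thesis .
qed

text \<open>The equality case of the Kruskal--Katona theorem for \<open>n + 2\<close> sets of size \<open>n + 1\<close>. Adding the
  sets one at a time, the \<open>i\<close>-th one loses at most one shadow set to each of its predecessors; equality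
  forces distinct losses.\<close>

lemma small_shadow_imp_simplex:
  assumes n: "n \<ge> 1" and F: "finite F" "card F = n + 2" "\<And>S. S \<in> F \<Longrightarrow> card S = Suc n"
    and le: "card (shadow n F) \<le> (n + 2) choose n"
  shows "\<exists>W. card W = n + 2 \<and> (\<forall>S\<in>F. S \<subseteq> W)"
proof -
  \<comment> \<open>By equality \<open>A\<close>, \<open>B\<close>, \<open>C\<close> have at most
    \<open>3 * n\<close> shadow sets together, while \<open>A\<close> and \<open>B\<close> alone
    have at least \<open>2 * n + 1\<close>. So \<open>C\<close> brings at most \<open>n - 1\<close>
    new ones and loses at least two, which can only be its intersections with \<open>A\<close> and
    \<open>B\<close>.\<close>
  have inter: "card (C \<inter> A) = n \<and> card (C \<inter> B) = n \<and> C \<inter> A \<noteq> C \<inter> B"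
    if ABC: "A \<in> F" "B \<in> F" "C \<in> F" "A \<noteq> B" "A \<noteq> C" "B \<noteq> C" for A B C
  proof -
    have cards: "card {A, B, C} = 3" "card {A, B} = 2" "card {A} = 1" using ABC by auto
    \<comment> \<open>The terms are \<open>n + 1\<close>, \<open>n\<close>, \<open>n - 1\<close>;
      the last is not truncated because \<open>n\<close> is positive.\<close>
    have "(\<Sum>i<3. Suc n - i) = 3 * n" using n by (simp add: numeral_3_eq_3)
    moreover have "card (shadow n {A, B, C}) + (\<Sum>i<n + 2. Suc n - i)
        \<le> card (shadow n F) + (\<Sum>i<3. Suc n - i)"
      using card_shadow_mono[OF F(1) _ F(3), of "{A, B, C}"] ABC unfolding cards F(2) by blast
    ultimately have "card (shadow n {A, B, C}) \<le> 3 * n"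
      using le unfolding sum_diff_eq_choose by linarith
    moreover have "card (shadow n {A}) + (\<Sum>i<card {A, B}. Suc n - i)
        \<le> card (shadow n {A, B}) + (\<Sum>i<card {A}. Suc n - i)"
      using ABC F(3) by (intro card_shadow_mono) blast+
    then have "card (shadow n {A}) + (\<Sum>i<2. Suc n - i) \<le> card (shadow n {A, B}) + (\<Sum>i<1. Suc n - i)"
      unfolding cards .
    then have "2 * n + 1 \<le> card (shadow n {A, B})"
      using card_shadow_singleton[OF F(3)[OF ABC(1)]] by (simp add: numeral_2_eq_2)
    moreover have "card (shadow n {A, B, C}) + card (shadow n {C} \<inter> shadow n {A, B})
        = Suc n + card (shadow n {A, B})"
    proof -
      have "insert C {A, B} = {A, B, C}" by blast
      moreover have "card S = Suc n" if "S \<in> insert C {A, B}" for S using that ABC F(3) by blast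
      ultimately show ?thesis using card_shadow_insert[of "{A, B}" C n] by simp
    qed
    ultimately have "2 \<le> card (shadow n {C} \<inter> shadow n {A, B})" by linarith
    also have "\<dots> \<le> card ((\<inter>) C ` {A, B} \<inter> {T. card T = n})"
      using ABC F(3) by (intro card_mono shadow_Int_subset) blast+
    also have "(\<inter>) C ` {A, B} \<inter> {T. card T = n} = {T. (T = C \<inter> A \<or> T = C \<inter> B) \<and> card T = n}" by auto
    finally have ge: "2 \<le> card {T. (T = C \<inter> A \<or> T = C \<inter> B) \<and> card T = n}" .
    have False if sub: "{T. (T = C \<inter> A \<or> T = C \<inter> B) \<and> card T = n} \<subseteq> {X}" for X
      using ge card_mono[OF _ sub] by simp
    then show ?thesis by blast
  qed
  obtain A B C where ABC: "A \<in> F" "B \<in> F" "C \<in> F" "A \<noteq> B" "A \<noteq> C" "B \<noteq> C"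
  proof -
    have "3 \<le> card F" using F(2) n by simp
    then obtain G where "G \<subseteq> F" "card G = 3"
      using obtain_subset_with_card_n by metis
    then obtain A B C where "{A, B, C} \<subseteq> F" "A \<noteq> B" "A \<noteq> C" "B \<noteq> C"
      unfolding card_3_iff by blast
    then show thesis by (intro that[of A B C]) blast+
  qed
  have fin: "finite S" if "S \<in> F" for S
    using F(3)[OF that] card.infinite by fastforce
  have "card (A \<union> B) = n + 2"
    using inter[OF ABC(2,3,1,6)] ABC(4,5) card_Un_Int[OF fin[OF ABC(1)] fin[OF ABC(2)]] F(3)[OF ABC(1)] F(3)[OF ABC(2)]
    by auto
  \<comment> \<open>\<open>S\<close> meets \<open>A\<close> and \<open>B\<close> in different sets
    of size \<open>n\<close>, so it meets their union in more than \<open>n\<close> of its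
    \<open>n + 1\<close> elements.\<close>
  moreover have "S \<subseteq> A \<union> B" if S: "S \<in> F" for S
  proof (cases "S = A \<or> S = B")
    case False
    then have i: "card (S \<inter> A) = n" "card (S \<inter> B) = n" "S \<inter> A \<noteq> S \<inter> B"
      using inter[OF ABC(1,2) S] ABC by auto
    have "\<not> S \<inter> B \<subseteq> S \<inter> A"
      using i card_subset_eq[of "S \<inter> A" "S \<inter> B"] fin[OF S] by auto
    then have "S \<inter> A \<subset> S \<inter> (A \<union> B)" by blast
    then have "n < card (S \<inter> (A \<union> B))"
      using psubset_card_mono[of "S \<inter> (A \<union> B)"] fin[OF S] i(1) by auto
    then have "S \<inter> (A \<union> B) = S"
      using F(3)[OF S] fin[OF S] by (intro card_seteq) auto
    then show ?thesis by blast
  qed auto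
  ultimately show ?thesis by blast
qed

section \<open>Sets with a common neighbor\<close>

text \<open>Adjacency is a predicate kept apart from the vertex set, so passing to a union of
  components only shrinks \<open>V\<close>.\<close>

definition common_nbr_sets :: "('a \<Rightarrow> 'a \<Rightarrow> bool) \<Rightarrow> 'a set \<Rightarrow> nat \<Rightarrow> 'a set set" where
  "common_nbr_sets E V k = {S. S \<subseteq> V \<and> card S = k \<and> (\<exists>v\<in>V. \<forall>x\<in>S. E v x)}"

lemma finite_common_nbr_sets: "finite V \<Longrightarrow> finite (common_nbr_sets E V k)"
  by (rule finite_subset[of _ "Pow V"]) (auto simp: common_nbr_sets_def)

lemma common_nbr_sets_cong:
  assumes "\<And>x y. x \<in> V \<Longrightarrow> y \<in> V \<Longrightarrow> E x y = E' x y"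
  shows "common_nbr_sets E V k = common_nbr_sets E' V k"
  using assms unfolding common_nbr_sets_def by blast

text \<open>A common neighbor forces the whole set onto its own side of the cut. The empty set would
  be counted on both sides, hence \<open>k \<ge> 1\<close>.\<close>

lemma card_common_nbr_sets_split:
  assumes "finite V" "W \<subseteq> V" "k \<ge> 1"
    and no: "\<And>x y. x \<in> W \<Longrightarrow> y \<in> V - W \<Longrightarrow> \<not> E x y \<and> \<not> E y x"
  shows "card (common_nbr_sets E V k) = card (common_nbr_sets E W k) + card (common_nbr_sets E (V - W) k)"
proof -
  have "common_nbr_sets E V k \<subseteq> common_nbr_sets E W k \<union> common_nbr_sets E (V - W) k"
  proof
    fix S assume "S \<in> common_nbr_sets E V k"
    then obtain v where S: "S \<subseteq> V" "card S = k" "v \<in> V" "\<forall>x\<in>S. E v x"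
      by (auto simp: common_nbr_sets_def)
    show "S \<in> common_nbr_sets E W k \<union> common_nbr_sets E (V - W) k"
    proof (cases "v \<in> W")
      case True
      then have "S \<subseteq> W" using S no by blast
      then show ?thesis using S True by (auto simp: common_nbr_sets_def)
    next
      case False
      then have "S \<subseteq> V - W" using S no by blast
      then show ?thesis using S False by (auto simp: common_nbr_sets_def)
    qed
  qed
  then have eq: "common_nbr_sets E V k = common_nbr_sets E W k \<union> common_nbr_sets E (V - W) k"
    using assms(2) by (auto simp: common_nbr_sets_def)
  have "common_nbr_sets E W k \<inter> common_nbr_sets E (V - W) k = {}"
  proof -
    have False if "S \<subseteq> W" "S \<subseteq> V - W" "card S = k" for S
    proof -
      have "S = {}" using that by blast
      then show False using that assms(3) by simp
    qed
    then show ?thesis by (auto simp: common_nbr_sets_def)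
  qed
  then show ?thesis
    unfolding eq using assms(1,2) finite_subset
    by (intro card_Un_disjoint finite_common_nbr_sets) auto
qed

section \<open>Disjoint unions of cliques with prescribed sizes\<close>

definition clique_partition ::
  "('a \<Rightarrow> 'a \<Rightarrow> bool) \<Rightarrow> 'a set \<Rightarrow> 'i set \<Rightarrow> ('i \<Rightarrow> nat) \<Rightarrow> ('a \<Rightarrow> 'i) \<Rightarrow> bool" where
  "clique_partition E V I a c \<longleftrightarrow> c ` V \<subseteq> I \<and> (\<forall>i\<in>I. card {x \<in> V. c x = i} = a i)
    \<and> (\<forall>x\<in>V. \<forall>y\<in>V. E x y \<longleftrightarrow> x \<noteq> y \<and> c x = c y)"

lemma card_proper_subsets:
  assumes "finite A"
  shows "card {S. S \<subset> A \<and> card S = k} = (if k = card A then 0 else card A choose k)"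
proof (cases "k = card A")
  case True
  have "card S \<noteq> k" if "S \<subset> A" for S
    using psubset_card_mono[OF assms that] True by simp
  then have "{S. S \<subset> A \<and> card S = k} = {}" by blast
  then show ?thesis using True by (metis card.empty)
next
  case False
  then have "{S. S \<subset> A \<and> card S = k} = {S. S \<subseteq> A \<and> card S = k}"
    unfolding psubset_eq by blast
  then show ?thesis using n_subsets[OF assms] False by simp
qed

text \<open>A nonempty set has a common neighbor iff it is a proper subset of one clique, since no
  vertex is its own neighbor. Hence a clique of size exactly \<open>k\<close> contributes 0.\<close>

lemma card_common_nbr_sets_clique_partition:
  assumes "finite V" "finite I" "clique_partition E V I a c" "k \<ge> 1"
  shows "card (common_nbr_sets E V k) = (\<Sum>i\<in>I. if k = a i then 0 else a i choose k)"
proof -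
  let ?V = "\<lambda>i. {x \<in> V. c x = i}"
  let ?P = "\<lambda>i. {S. S \<subset> ?V i \<and> card S = k}"
  have c: "c ` V \<subseteq> I" "\<And>i. i \<in> I \<Longrightarrow> card (?V i) = a i"
      "\<And>x y. x \<in> V \<Longrightarrow> y \<in> V \<Longrightarrow> E x y \<longleftrightarrow> x \<noteq> y \<and> c x = c y"
    using assms(3) unfolding clique_partition_def by blast+
  have "common_nbr_sets E V k = (\<Union>i\<in>I. ?P i)"
  proof (intro set_eqI iffI)
    fix S assume "S \<in> common_nbr_sets E V k"
    then obtain v where S: "S \<subseteq> V" "card S = k" "v \<in> V" "\<forall>x\<in>S. E v x"
      by (auto simp: common_nbr_sets_def)
    then have "S \<subset> ?V (c v)" "c v \<in> I" using c(1) c(3)[OF S(3)] by force+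
    then show "S \<in> (\<Union>i\<in>I. ?P i)" using S by auto
  next
    fix S assume "S \<in> (\<Union>i\<in>I. ?P i)"
    then obtain i v where S: "S \<subset> ?V i" "card S = k" "v \<in> ?V i" "v \<notin> S" by blast
    then have "\<forall>x\<in>S. E v x" using c(3) by (auto 4 3)
    then show "S \<in> common_nbr_sets E V k" using S by (auto simp: common_nbr_sets_def)
  qed
  also have "card \<dots> = (\<Sum>i\<in>I. card (?P i))"
  proof (rule card_UN_disjoint[OF assms(2)])
    show "\<forall>i\<in>I. finite (?P i)"
      using assms(1) by (auto intro: finite_subset[of _ "Pow V"])
    have False if "S \<subseteq> ?V i" "S \<subseteq> ?V j" "card S = k" "i \<noteq> j" for S i j
    proof -
      have "S = {}" using that by blast
      then show False using that assms(4) by simp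
    qed
    then show "\<forall>i\<in>I. \<forall>j\<in>I. i \<noteq> j \<longrightarrow> ?P i \<inter> ?P j = {}" by blast
  qed
  also have "\<dots> = (\<Sum>i\<in>I. if k = a i then 0 else a i choose k)"
    using assms(1) c(2) by (intro sum.cong) (simp_all add: card_proper_subsets)
  finally show ?thesis .
qed

section \<open>Splitting off the largest clique\<close>

text \<open>The counts say that all degrees are at most \<open>n + 1\<close> and that exactly
  \<open>n + 2\<close> sets occur as neighborhoods of that size. Their shadow is small enough to
  make them the facets of a simplex \<open>W\<close>; symmetry of \<open>E\<close> then identifies
  the neighborhoods of the vertices in \<open>W\<close>.\<close>

lemma clique_component_large:
  assumes V: "finite V" and E: "symp E" "irreflp E" and n: "n \<ge> 1"
    and c2: "card (common_nbr_sets E V (n + 2)) = 0"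
    and c1: "card (common_nbr_sets E V (n + 1)) = n + 2"
    and c0: "card (common_nbr_sets E V n) = (n + 2) choose n"
  shows "\<exists>W\<subseteq>V. card W = n + 2 \<and> (\<forall>x\<in>W. \<forall>y\<in>V. E x y \<longleftrightarrow> x \<noteq> y \<and> y \<in> W)"
proof -
  define Nb where "Nb v = {u \<in> V. E v u}" for v
  have Nb_fin: "finite (Nb v)" for v using V by (simp add: Nb_def)
  have Nb_le: "card (Nb v) \<le> n + 1" if "v \<in> V" for v
  proof (rule ccontr)
    assume "\<not> ?thesis"
    then have "n + 2 \<le> card (Nb v)" by simp
    then obtain S where "S \<subseteq> Nb v" "card S = n + 2"
      by (rule obtain_subset_with_card_n)
    then have "S \<in> common_nbr_sets E V (n + 2)"
      using that by (auto simp: common_nbr_sets_def Nb_def)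
    then show False using c2 finite_common_nbr_sets[OF V] by auto
  qed
  have Nb_eq: "Nb v = S" if "v \<in> V" "S \<subseteq> Nb v" "card S = n + 1" for v S
    using card_seteq[OF Nb_fin that(2)] Nb_le[OF that(1)] that(3) by simp
  define F where "F = common_nbr_sets E V (n + 1)"
  have finF: "finite F" unfolding F_def by (rule finite_common_nbr_sets[OF V])
  \<comment> \<open>Subsets inherit a common neighbor.\<close>
  have "shadow n F \<subseteq> common_nbr_sets E V n"
    unfolding shadow_def F_def common_nbr_sets_def by blast
  then have "card (shadow n F) \<le> (n + 2) choose n"
    using card_mono[OF finite_common_nbr_sets[OF V], of "shadow n F" E n] c0 by simp
  then obtain W where W: "card W = n + 2" "\<And>S. S \<in> F \<Longrightarrow> S \<subseteq> W"
  proof -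
    have "card S = Suc n" if "S \<in> F" for S
      using that by (simp add: F_def common_nbr_sets_def)
    then have "\<exists>W. card W = n + 2 \<and> (\<forall>S\<in>F. S \<subseteq> W)"
      using \<open>card (shadow n F) \<le> (n + 2) choose n\<close> c1 n finF
      by (intro small_shadow_imp_simplex) (simp_all add: F_def)
    then show thesis using that by blast
  qed
  have finW: "finite W" using W(1) card.infinite by fastforce
  \<comment> \<open>\<open>W\<close> has \<open>n + 2\<close> subsets of size \<open>n + 1\<close>,
    as many as \<open>F\<close> has members.\<close>
  have F_eq: "F = {S. S \<subseteq> W \<and> card S = n + 1}"
  proof (rule card_subset_eq)
    have "(n + 2) choose (n + 1) = n + 2"
      using binomial_Suc_n[of "Suc n"] by simp
    then show "card F = card {S. S \<subseteq> W \<and> card S = n + 1}"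
      using n_subsets[OF finW, of "n + 1"] c1 W(1) by (simp add: F_def)
    show "finite {S. S \<subseteq> W \<and> card S = n + 1}" using finW by simp
    show "F \<subseteq> {S. S \<subseteq> W \<and> card S = n + 1}"
      using W(2) by (auto simp: F_def common_nbr_sets_def)
  qed
  have minus: "card (W - {w}) = n + 1" if "w \<in> W" for w
    using that W(1) finW by simp
  \<comment> \<open>A common neighbor of \<open>W - {w}\<close> already has \<open>n + 1\<close>
    neighbors there, hence no others.\<close>
  have "\<forall>w\<in>W. \<exists>v\<in>V. Nb v = W - {w}"
  proof
    fix w assume "w \<in> W"
    then have "W - {w} \<in> common_nbr_sets E V (n + 1)"
      using F_eq minus[OF \<open>w \<in> W\<close>] unfolding F_def by blast
    then obtain v where "v \<in> V" "W - {w} \<subseteq> Nb v"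
      by (auto simp: common_nbr_sets_def Nb_def)
    then show "\<exists>v\<in>V. Nb v = W - {w}" using Nb_eq minus[OF \<open>w \<in> W\<close>] by blast
  qed
  then obtain v where v: "\<And>w. w \<in> W \<Longrightarrow> v w \<in> V" "\<And>w. w \<in> W \<Longrightarrow> Nb (v w) = W - {w}"
    by metis
  have inj: "inj_on v W"
  proof (rule inj_onI)
    fix x y assume xy: "x \<in> W" "y \<in> W" "v x = v y"
    then have "W - {x} = W - {y}" using v(2) by metis
    then show "x = y" using xy by blast
  qed
  have other: "\<exists>w'\<in>W. w' \<noteq> w" for w
  proof -
    have "\<not> W \<subseteq> {w}" using card_mono[of "{w}" W] W(1) by auto
    then show ?thesis by blast
  qed
  have WV: "W \<subseteq> V"
  proof
    fix w assume "w \<in> W"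
    then obtain w' where "w' \<in> W" "w' \<noteq> w" using other by blast
    then have "w \<in> Nb (v w')" using v(2) \<open>w \<in> W\<close> by auto
    then show "w \<in> V" by (simp add: Nb_def)
  qed
  \<comment> \<open>By symmetry \<open>w\<close> is adjacent to the \<open>n + 1\<close> vertices
    \<open>v w'\<close> with \<open>w'\<close> different from \<open>w\<close>, which exhausts its
    degree. That \<open>v\<close> fixes \<open>W\<close> pointwise is not known yet.\<close>
  have Nb_w: "Nb w = v ` (W - {w})" if w: "w \<in> W" for w
  proof (rule Nb_eq)
    show "w \<in> V" using w WV by blast
    show "v ` (W - {w}) \<subseteq> Nb w"
    proof
      fix u assume "u \<in> v ` (W - {w})"
      then obtain w' where w': "w' \<in> W" "w' \<noteq> w" "u = v w'" by auto
      then have "w \<in> Nb u" using v(2) w by auto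
      then show "u \<in> Nb w" using v(1) w' sympD[OF E(1)] by (auto simp: Nb_def)
    qed
    show "card (v ` (W - {w})) = n + 1"
      using minus[OF w] card_image[OF inj_on_subset[OF inj, of "W - {w}"]] by auto
  qed
  \<comment> \<open>The neighborhood of \<open>w\<close> has size \<open>n + 1\<close>, so it
    belongs to \<open>F\<close> and lies in \<open>W\<close>; irreflexivity excludes
    \<open>w\<close>, and only \<open>W - {w}\<close> remains.\<close>
  have Nb_W: "Nb w = W - {w}" if w: "w \<in> W" for w
  proof (rule card_subset_eq)
    have c: "card (Nb w) = n + 1"
      unfolding Nb_w[OF w] using minus[OF w] card_image[OF inj_on_subset[OF inj, of "W - {w}"]] by auto
    have "Nb w \<in> F"
      unfolding F_def common_nbr_sets_def using c w WV by (auto simp: Nb_def)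
    then have "Nb w \<subseteq> W" by (rule W(2))
    moreover have "w \<notin> Nb w" using E(2) by (auto simp: Nb_def irreflp_def)
    ultimately show "Nb w \<subseteq> W - {w}" by blast
    show "card (Nb w) = card (W - {w})" using c minus[OF w] by simp
  qed (use finW in simp)
  have "E x y \<longleftrightarrow> x \<noteq> y \<and> y \<in> W" if "x \<in> W" "y \<in> V" for x y
  proof -
    have "E x y \<longleftrightarrow> y \<in> Nb x" using that by (simp add: Nb_def)
    then show ?thesis using Nb_W[OF that(1)] by auto
  qed
  then show ?thesis using WV W(1) by blast
qed

text \<open>If the maximum is at least 3, the gap makes the counts at the three largest relevant
  \<open>k\<close> depend on class \<open>i\<close> alone. If it is at most 2, several classes may
  attain it, but \<open>E\<close> is then a matching and any vertex or edge of the right kind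
  serves.\<close>

lemma clique_component_max:
  fixes a :: "'i \<Rightarrow> nat"
  assumes V: "finite V" and E: "symp E" "irreflp E" and I: "finite I" "i \<in> I"
    and ge1: "a i \<ge> 1"
    and max: "\<And>j. j \<in> I \<Longrightarrow> a j \<le> a i"
    and gap: "\<And>j. j \<in> I \<Longrightarrow> j \<noteq> i \<Longrightarrow> a i \<le> 2 \<or> a j + 2 \<le> a i"
    and card: "card V = (\<Sum>j\<in>I. a j)"
    and counts: "\<And>k. k \<ge> 1 \<Longrightarrow>
      card (common_nbr_sets E V k) = (\<Sum>j\<in>I. if k = a j then 0 else a j choose k)"
  shows "\<exists>W\<subseteq>V. card W = a i \<and> (\<forall>x\<in>W. \<forall>y\<in>V. E x y \<longleftrightarrow> x \<noteq> y \<and> y \<in> W)"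
proof -
  \<comment> \<open>At \<open>k = a i\<close> classes of maximal size contribute 0 by the
    \<open>if\<close>, smaller ones by the binomial coefficient. So every degree is below
    \<open>a i\<close>.\<close>
  have top: "common_nbr_sets E V (a i) = {}"
  proof -
    have "card (common_nbr_sets E V (a i)) = 0"
      unfolding counts[OF ge1] using max by (intro sum.neutral) (fastforce simp: le_less)+
    then show ?thesis using finite_common_nbr_sets[OF V] by simp
  qed
  have edge: "{y} \<in> common_nbr_sets E V 1" if "x \<in> V" "y \<in> V" "E x y" for x y
    using that by (auto simp: common_nbr_sets_def)
  consider "a i = 1" | "a i = 2" | "a i \<ge> 3" using ge1 by linarith
  then show ?thesis
  proof cases
    case 1
    have "a i \<le> card V" unfolding card using I by (intro member_le_sum) auto
    then obtain x where "x \<in> V" using 1 by fastforce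
    moreover have "\<not> E x y" if "y \<in> V" for y
      using top 1 edge[OF \<open>x \<in> V\<close> that] by auto
    ultimately show ?thesis using 1 by (intro exI[of _ "{x}"]) auto
  next
    case 2
    have "(if 1 = a i then 0 else a i choose 1) \<le> card (common_nbr_sets E V 1)"
      unfolding counts[OF order_refl] using I by (intro member_le_sum) auto
    then have "common_nbr_sets E V 1 \<noteq> {}" using 2 by auto
    then obtain x y where xy: "x \<in> V" "y \<in> V" "E x y"
      by (auto simp: common_nbr_sets_def card_1_singleton_iff)
    have yx: "E y x" using xy sympD[OF E(1)] by blast
    have uniq: "u = w" if "u \<in> V" "w \<in> V" "z \<in> V" "E z u" "E z w" for u w z
    proof (rule ccontr)
      assume "u \<noteq> w"
      then have "{u, w} \<in> common_nbr_sets E V 2"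
        using that by (auto simp: common_nbr_sets_def)
      then show False using top 2 by simp
    qed
    have irr: "\<not> E z z" for z using E(2) by (simp add: irreflp_def)
    have "x \<noteq> y" using xy irr by auto
    show ?thesis
    proof (intro exI[of _ "{x, y}"] conjI ballI)
      fix u w assume "u \<in> {x, y}" "w \<in> V"
      then show "E u w \<longleftrightarrow> u \<noteq> w \<and> w \<in> {x, y}"
        using xy yx irr uniq by blast
    qed (use xy \<open>x \<noteq> y\<close> 2 in auto)
  next
    case 3
    define n where "n = a i - 2"
    have n: "a i = n + 2" "n \<ge> 1" using 3 by (simp_all add: n_def)
    have small: "a j \<le> n" if "j \<in> I" "j \<noteq> i" for j
      using gap[OF that] n by auto
    \<comment> \<open>A class of size exactly \<open>n\<close> contributes 0 at \<open>k = n\<close>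
      as well, which is why a gap of two suffices for \<open>k = n\<close>.\<close>
    have only: "card (common_nbr_sets E V k) = (n + 2) choose k" if k: "n \<le> k" "k < n + 2" for k
    proof -
      have "card (common_nbr_sets E V k) = (\<Sum>j\<in>I. if k = a j then 0 else a j choose k)"
        using counts k n by simp
      also have "\<dots> = (if k = a i then 0 else a i choose k)
          + (\<Sum>j\<in>I - {i}. if k = a j then 0 else a j choose k)"
        using I by (intro sum.remove)
      also have "(\<Sum>j\<in>I - {i}. if k = a j then 0 else a j choose k) = 0"
        using small k by (intro sum.neutral) (fastforce simp: le_less)
      finally show ?thesis using k n by simp
    qed
    have "(n + 2) choose (n + 1) = n + 2"
      using binomial_Suc_n[of "Suc n"] by simp
    then show ?thesis
      unfolding n(1) using top only n(1) by (intro clique_component_large[OF V E n(2)]) simp_all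
  qed
qed

text \<open>Induction on \<open>I\<close>: the component found for a largest class is removed
  together with its index. Counts are additive over components, so subtraction leaves the counts
  prescribed by the remaining classes.\<close>

lemma clique_partition_of_counts:
  fixes a :: "'i \<Rightarrow> nat"
  assumes "finite V" "symp E" "irreflp E" "finite I"
    and "\<And>i. i \<in> I \<Longrightarrow> a i \<ge> 1"
    and "\<And>i j. i \<in> I \<Longrightarrow> j \<in> I \<Longrightarrow> i \<noteq> j \<Longrightarrow> a j \<le> a i \<Longrightarrow> a i \<le> 2 \<or> a j + 2 \<le> a i"
    and "card V = (\<Sum>j\<in>I. a j)"
    and "\<And>k. k \<ge> 1 \<Longrightarrow>
      card (common_nbr_sets E V k) = (\<Sum>j\<in>I. if k = a j then 0 else a j choose k)"
  shows "\<exists>c. clique_partition E V I a c"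
  using assms(4,1,5-)
proof (induction arbitrary: V rule: finite_psubset_induct)
  case (psubset I)
  show ?case
  proof (cases "I = {}")
    case True
    then show ?thesis using psubset.prems by (simp add: clique_partition_def)
  next
    case False
    then have "Max (a ` I) \<in> a ` I" using psubset.hyps by (intro Max_in) auto
    then obtain i where "i \<in> I" "a i = Max (a ` I)" by (elim imageE) simp
    then have i: "i \<in> I" "\<And>j. j \<in> I \<Longrightarrow> a j \<le> a i" using psubset.hyps by simp_all
    obtain W where W: "W \<subseteq> V" "card W = a i" "\<And>x y. x \<in> W \<Longrightarrow> y \<in> V \<Longrightarrow> E x y \<longleftrightarrow> x \<noteq> y \<and> y \<in> W"
    proof -
      have "\<exists>W\<subseteq>V. card W = a i \<and> (\<forall>x\<in>W. \<forall>y\<in>V. E x y \<longleftrightarrow> x \<noteq> y \<and> y \<in> W)"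
        using psubset.prems(2,3) i
        by (intro clique_component_max[OF psubset.prems(1) assms(2,3) psubset.hyps(1)] psubset.prems(4,5)) auto
      then show thesis using that by blast
    qed
    have W': "E y x \<longleftrightarrow> x \<noteq> y \<and> y \<in> W" if "x \<in> W" "y \<in> V" for x y
      using W(3)[OF that] sympD[OF assms(2), of x y] sympD[OF assms(2), of y x] by blast
    have finW: "finite W" using W(1) psubset.prems(1) finite_subset by blast
    have "clique_partition E W {i} a (\<lambda>_. i)"
      unfolding clique_partition_def using W by auto
    then have cW: "card (common_nbr_sets E W k) = (if k = a i then 0 else a i choose k)" if "k \<ge> 1" for k
      using card_common_nbr_sets_clique_partition[OF finW, of "{i}"] that by fastforce
    have "\<exists>c. clique_partition E (V - W) (I - {i}) a c"
    proof (rule psubset.IH)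
      show "I - {i} \<subset> I" using i(1) by blast
      show "card (V - W) = (\<Sum>j\<in>I - {i}. a j)"
        using card_Diff_subset[OF finW W(1)] psubset.prems(4) W(2) sum.remove[OF psubset.hyps i(1), of a] by simp
      fix k :: nat assume k: "k \<ge> 1"
      have "card (common_nbr_sets E V k) = card (common_nbr_sets E W k) + card (common_nbr_sets E (V - W) k)"
        using W W' by (intro card_common_nbr_sets_split psubset.prems(1) k) auto
      then show "card (common_nbr_sets E (V - W) k) = (\<Sum>j\<in>I - {i}. if k = a j then 0 else a j choose k)"
        using psubset.prems(5)[OF k] cW[OF k]
          sum.remove[OF psubset.hyps i(1), of "\<lambda>j. if k = a j then 0 else a j choose k"] by simp
    qed (use psubset.prems in auto)
    then obtain c where c: "c ` (V - W) \<subseteq> I - {i}"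
        "\<And>j. j \<in> I - {i} \<Longrightarrow> card {x \<in> V - W. c x = j} = a j"
        "\<And>x y. x \<in> V - W \<Longrightarrow> y \<in> V - W \<Longrightarrow> E x y \<longleftrightarrow> x \<noteq> y \<and> c x = c y"
      unfolding clique_partition_def by blast
    let ?c = "\<lambda>x. if x \<in> W then i else c x"
    \<comment> \<open>The color \<open>i\<close> is free outside \<open>W\<close>, so the two
      colorings can be glued.\<close>
    have ni: "c x \<noteq> i" if "x \<in> V - W" for x using c(1) that by blast
    have "clique_partition E V I a ?c"
      unfolding clique_partition_def
    proof (intro conjI ballI)
      show "?c ` V \<subseteq> I" using c(1) i(1) by auto
    next
      fix j assume j: "j \<in> I"
      have "{x \<in> V. ?c x = j} = (if j = i then W else {x \<in> V - W. c x = j})"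
        using W(1) ni by auto
      then show "card {x \<in> V. ?c x = j} = a j" using j W(2) c(2) by simp
    next
      fix x y assume "x \<in> V" "y \<in> V"
      then show "E x y \<longleftrightarrow> x \<noteq> y \<and> ?c x = ?c y"
        using W(3) W' c(3) ni by (metis DiffI)
    qed
    then show ?thesis by blast
  qed
qed

section \<open>Domination polynomials through the complement graph\<close>

definition co_adj :: "'a pair_pre_digraph \<Rightarrow> 'a \<Rightarrow> 'a \<Rightarrow> bool" where
  "co_adj G u v \<longleftrightarrow> u \<in> pverts G \<and> v \<in> pverts G \<and> u \<noteq> v \<and> (u, v) \<notin> parcs G"

lemma irreflp_co_adj: "irreflp (co_adj G)"
  by (simp add: irreflp_def co_adj_def)

context pair_graph
begin

lemma parcs_sym: "(u, v) \<in> parcs G \<longleftrightarrow> (v, u) \<in> parcs G"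
  using pair_sym_arcs unfolding symmetric_def sym_def by simp blast

lemma symp_co_adj: "symp (co_adj G)"
  unfolding symp_def co_adj_def using parcs_sym by blast

text \<open>Among vertices, lying outside the closed neighborhood of \<open>x\<close> means being
  adjacent to \<open>x\<close> in the complement. A vertex missed by \<open>S\<close> is thus a
  common neighbor of \<open>S\<close> there.\<close>

lemma dominating_set_iff:
  "dominating_set G S \<longleftrightarrow> S \<subseteq> pverts G \<and> \<not> (\<exists>v\<in>pverts G. \<forall>x\<in>S. co_adj G v x)"
proof (cases "S \<subseteq> pverts G")
  case True
  then have sub: "(\<Union>x\<in>S. closed_nbhd G x) \<subseteq> pverts G"
    using arc_snd_in_verts by (fastforce simp: closed_nbhd_def)
  have iff: "v \<in> closed_nbhd G x \<longleftrightarrow> \<not> co_adj G v x" if "v \<in> pverts G" "x \<in> S" for v x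
    using that True parcs_sym[of v x] by (auto simp: closed_nbhd_def co_adj_def)
  have "dominating_set G S \<longleftrightarrow> pverts G \<subseteq> (\<Union>x\<in>S. closed_nbhd G x)"
    unfolding dominating_set_def using sub True by (simp add: set_eq_subset)
  also have "\<dots> \<longleftrightarrow> (\<forall>v\<in>pverts G. \<exists>x\<in>S. \<not> co_adj G v x)"
    unfolding subset_iff UN_iff using iff by (simp cong: ball_cong bex_cong) blast
  finally show ?thesis using True by simp
qed (simp add: dominating_set_def)

lemma dom_count_add:
  "dom_count G k + card (common_nbr_sets (co_adj G) (pverts G) k) = card (pverts G) choose k"
proof -
  have "{S. dominating_set G S \<and> card S = k} \<union> common_nbr_sets (co_adj G) (pverts G) k
      = {S. S \<subseteq> pverts G \<and> card S = k}"
    by (auto simp: dominating_set_iff common_nbr_sets_def)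
  moreover have "{S. dominating_set G S \<and> card S = k} \<inter> common_nbr_sets (co_adj G) (pverts G) k = {}"
    by (auto simp: dominating_set_iff common_nbr_sets_def)
  moreover have "finite {S. dominating_set G S \<and> card S = k}"
    by (rule finite_subset[of _ "Pow (pverts G)"]) (auto simp: dominating_set_def)
  ultimately show ?thesis
    unfolding dom_count_def
    using card_Un_disjoint[of "{S. dominating_set G S \<and> card S = k}" "common_nbr_sets (co_adj G) (pverts G) k"]
      finite_common_nbr_sets[OF pair_finite_verts] n_subsets[OF pair_finite_verts, of k] by simp
qed

text \<open>The index 0 is separate because the sum starts at 1, although the empty set dominates
  the empty graph. Beyond the number of vertices \<open>dom_count\<close> vanishes.\<close>

lemma coeff_domination_poly:
  "coeff (domination_poly G) k = (if k = 0 then 0 else int (dom_count G k))"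
proof -
  have "coeff (domination_poly G) k
      = (\<Sum>i = 1..card (pverts G). if i = k then int (dom_count G i) else 0)"
    unfolding domination_poly_def coeff_sum by (intro sum.cong) (auto simp: coeff_monom)
  also have "\<dots> = (if k = 0 then 0 else int (dom_count G k))"
    using dom_count_add[of k] by (auto simp: not_le binomial_eq_0)
  finally show ?thesis .
qed

text \<open>The full vertex set dominates, so the top coefficient is nonzero. The polynomial
  therefore determines the number of vertices, and with it the binomial coefficients in
  \<open>dom_count_add\<close>.\<close>

lemma degree_domination_poly: "degree (domination_poly G) = card (pverts G)"
proof (rule antisym)
  show "degree (domination_poly G) \<le> card (pverts G)"
    unfolding domination_poly_def
    by (intro degree_sum_le) (auto intro: order_trans[OF degree_monom_le])
  show "card (pverts G) \<le> degree (domination_poly G)"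
  proof (cases "card (pverts G) = 0")
    case False
    have "common_nbr_sets (co_adj G) (pverts G) (card (pverts G)) = {}"
    proof -
      have "S = pverts G" if "S \<subseteq> pverts G" "card S = card (pverts G)" for S
        using that card_subset_eq[OF pair_finite_verts] by blast
      then show ?thesis by (auto simp: common_nbr_sets_def co_adj_def)
    qed
    then show ?thesis
      using dom_count_add[of "card (pverts G)"] False
      by (intro le_degree) (simp add: coeff_domination_poly)
  qed simp
qed

end

lemma domination_poly_eq_iff:
  assumes "pair_graph G" "pair_graph H"
  shows "domination_poly G = domination_poly H \<longleftrightarrow> card (pverts G) = card (pverts H) \<and>
    (\<forall>k\<ge>1. card (common_nbr_sets (co_adj G) (pverts G) k) = card (common_nbr_sets (co_adj H) (pverts H) k))"
    (is "_ \<longleftrightarrow> ?n \<and> ?c")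
proof -
  interpret G: pair_graph G by fact
  interpret H: pair_graph H by fact
  have n: ?n if "domination_poly G = domination_poly H"
    using that G.degree_domination_poly H.degree_domination_poly by simp
  have "domination_poly G = domination_poly H \<longleftrightarrow> (\<forall>k\<ge>1. dom_count G k = dom_count H k)"
    unfolding poly_eq_iff G.coeff_domination_poly H.coeff_domination_poly
    by (auto simp: Suc_le_eq)
  moreover have "dom_count G k = dom_count H k \<longleftrightarrow>
      card (common_nbr_sets (co_adj G) (pverts G) k) = card (common_nbr_sets (co_adj H) (pverts H) k)"
    if ?n for k
    using G.dom_count_add[of k] H.dom_count_add[of k] that by simp linarith
  ultimately show ?thesis using n by blast
qed

section \<open>Complete multipartite graphs\<close>

lemma pverts_complete_multipartite: "pverts (complete_multipartite r a) = (SIGMA i:{1..r}. {1..a i})"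
  by (simp add: complete_multipartite_def Let_def)

lemma co_adj_complete_multipartite:
  "co_adj (complete_multipartite r a) u v \<longleftrightarrow>
    u \<in> pverts (complete_multipartite r a) \<and> v \<in> pverts (complete_multipartite r a) \<and> u \<noteq> v \<and> fst u = fst v"
  by (auto simp: co_adj_def complete_multipartite_def Let_def)

lemma clique_partition_complete_multipartite:
  "clique_partition (co_adj (complete_multipartite r a)) (pverts (complete_multipartite r a)) {1..r} a fst"
proof -
  have "{x \<in> SIGMA i:{1..r}. {1..a i}. fst x = i} = Pair i ` {1..a i}" if "i \<in> {1..r}" for i
    using that by auto
  then have "card {x \<in> SIGMA i:{1..r}. {1..a i}. fst x = i} = a i" if "i \<in> {1..r}" for i
    using that by (simp add: card_image inj_on_def)
  then show ?thesis
    by (auto simp: clique_partition_def co_adj_complete_multipartite pverts_complete_multipartite)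
qed

text \<open>This allows graphs to be told apart by whether adjacency in the complement is transitive
  on distinct vertices.\<close>

lemma digraph_iso_co_adj:
  assumes "pair_wf_digraph G" "digraph_iso (with_proj G) (with_proj H)"
  shows "\<exists>f. bij_betw f (pverts G) (pverts H) \<and>
    (\<forall>u\<in>pverts G. \<forall>v\<in>pverts G. co_adj G u v \<longleftrightarrow> co_adj H (f u) (f v))"
proof -
  interpret pair_wf_digraph G by fact
  obtain f where f: "bij_betw f (pverts G) (pverts H)" "parcs H = map_prod f f ` parcs G"
    using assms(2) unfolding digraph_iso_pair_iff[OF assms(1)] by blast
  have inj: "f u = f v \<longleftrightarrow> u = v" if "u \<in> pverts G" "v \<in> pverts G" for u v
    using f(1) that by (auto simp: bij_betw_def inj_on_def)
  have mem: "f u \<in> pverts H" if "u \<in> pverts G" for u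
    using f(1) that by (auto simp: bij_betw_def)
  have "(f u, f v) \<in> parcs H \<longleftrightarrow> (u, v) \<in> parcs G" if uv: "u \<in> pverts G" "v \<in> pverts G" for u v
  proof
    assume "(f u, f v) \<in> parcs H"
    then obtain u' v' where "(u', v') \<in> parcs G" "f u = f u'" "f v = f v'"
      unfolding f(2) by auto
    moreover from this(1) have "u' \<in> pverts G" "v' \<in> pverts G"
      using arc_fst_in_verts arc_snd_in_verts by fastforce+
    ultimately show "(u, v) \<in> parcs G" using inj uv by simp
  qed (auto simp: f(2))
  then show ?thesis using f(1) inj mem unfolding co_adj_def by blast
qed

lemma digraph_iso_complete_multipartite:
  assumes "pair_graph H" and c: "clique_partition (co_adj H) (pverts H) {1..r} a c"
  shows "digraph_iso (with_proj H) (with_proj (complete_multipartite r a))"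
proof -
  interpret H: pair_graph H by fact
  have cI: "c x \<in> {1..r}" if "x \<in> pverts H" for x
    using c that unfolding clique_partition_def by blast
  have cE: "co_adj H x y \<longleftrightarrow> x \<noteq> y \<and> c x = c y" if "x \<in> pverts H" "y \<in> pverts H" for x y
    using c that unfolding clique_partition_def by blast
  have arcs: "(u, v) \<in> parcs H \<longleftrightarrow> u \<in> pverts H \<and> v \<in> pverts H \<and> c u \<noteq> c v" for u v
  proof -
    have "u \<in> pverts H \<and> v \<in> pverts H \<and> u \<noteq> v" if "(u, v) \<in> parcs H"
      using H.arc_fst_in_verts[OF that] H.arc_snd_in_verts[OF that] H.pair_no_loops[OF that] by simp
    then show ?thesis using cE[of u v] unfolding co_adj_def by blast
  qed
  \<comment> \<open>Within a color class any enumeration will do, since adjacency depends on colors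
    only.\<close>
  have "\<exists>h. bij_betw h {x \<in> pverts H. c x = i} {1..a i}" if "i \<in> {1..r}" for i
  proof -
    have "card {x \<in> pverts H. c x = i} = card {1..a i}"
      using c that unfolding clique_partition_def by auto
    then show ?thesis
      using H.pair_finite_verts by (intro finite_same_card_bij) auto
  qed
  then obtain h where h: "\<And>i. i \<in> {1..r} \<Longrightarrow> bij_betw (h i) {x \<in> pverts H. c x = i} {1..a i}"
    by metis
  let ?f = "\<lambda>x. (c x, h (c x) x)"
  have bij: "bij_betw ?f (pverts H) (pverts (complete_multipartite r a))"
    unfolding bij_betw_def pverts_complete_multipartite
  proof (intro conjI inj_onI set_eqI iffI)
    fix x y assume xy: "x \<in> pverts H" "y \<in> pverts H" "?f x = ?f y"
    then show "x = y"
      using inj_onD[OF bij_betw_imp_inj_on[OF h[OF cI[OF xy(1)]]], of x y] by auto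
  next
    fix p assume "p \<in> ?f ` pverts H"
    then show "p \<in> (SIGMA i:{1..r}. {1..a i})"
      using cI bij_betw_apply[OF h] by fastforce
  next
    fix p assume "p \<in> (SIGMA i:{1..r}. {1..a i})"
    then obtain i k where p: "p = (i, k)" "i \<in> {1..r}" "k \<in> {1..a i}" by blast
    then have "k \<in> h i ` {x \<in> pverts H. c x = i}"
      using bij_betw_imp_surj_on[OF h[OF p(2)]] by simp
    then obtain x where "x \<in> pverts H" "c x = i" "h i x = k" by blast
    then show "p \<in> ?f ` pverts H" using p by auto
  qed
  have "parcs (complete_multipartite r a) = map_prod ?f ?f ` parcs H"
  proof (intro set_eqI iffI)
    fix e assume "e \<in> parcs (complete_multipartite r a)"
    then obtain p q where e: "e = (p, q)" "p \<in> pverts (complete_multipartite r a)"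
        "q \<in> pverts (complete_multipartite r a)" "fst p \<noteq> fst q"
      by (auto simp: complete_multipartite_def Let_def)
    then obtain x y where "x \<in> pverts H" "y \<in> pverts H" "p = ?f x" "q = ?f y"
      using bij_betw_imp_surj_on[OF bij] by blast
    then show "e \<in> map_prod ?f ?f ` parcs H"
      using e arcs by (intro image_eqI[of _ _ "(x, y)"]) auto
  next
    fix e assume "e \<in> map_prod ?f ?f ` parcs H"
    then obtain x y where xy: "(x, y) \<in> parcs H" "e = (?f x, ?f y)" by auto
    then have "?f x \<in> pverts (complete_multipartite r a)" "?f y \<in> pverts (complete_multipartite r a)"
      using arcs bij_betw_apply[OF bij] by blast+
    then show "e \<in> parcs (complete_multipartite r a)"
      using xy arcs by (auto simp: complete_multipartite_def Let_def)
  qed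
  then show ?thesis
    using bij digraph_iso_pair_iff[OF H.pair_wf_digraph] by blast
qed

section \<open>Replacing two classes of almost equal size\<close>

text \<open>Between the classes \<open>i\<close> and \<open>j\<close> this is the bipartite graph in which the \<open>p\<close>-th vertex of \<open>i\<close> is
  joined to the \<open>q\<close>-th vertex of \<open>j\<close> iff \<open>p \<noteq> q\<close>: the tensor product of a clique with an edge, minus
  one vertex if the sizes differ.\<close>

definition swap_adj :: "nat \<Rightarrow> nat \<Rightarrow> nat \<times> nat \<Rightarrow> nat \<times> nat \<Rightarrow> bool" where
  "swap_adj i j u v \<longleftrightarrow>
    (if fst u \<in> {i, j} \<or> fst v \<in> {i, j}
     then {fst u, fst v} = {i, j} \<and> snd u \<noteq> snd v
     else u \<noteq> v \<and> fst u = fst v)"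

text \<open>After the swap the sets counted are those in one class that avoid some position
  occurring in the other class. For equal sizes these are again the proper subsets of
  \<open>X\<close> and of \<open>Y\<close>; otherwise one set is exchanged for another of the same
  size.\<close>

lemma card_common_nbr_sets_swap:
  assumes ij: "i \<noteq> j" and le: "b \<le> c" "c \<le> b + 1" and k: "k \<ge> 1"
  defines "X \<equiv> {i} \<times> {1..b}" and "Y \<equiv> {j} \<times> {1..c}"
  shows "card (common_nbr_sets (swap_adj i j) (X \<union> Y) k)
    = card (common_nbr_sets (\<lambda>u v. u \<noteq> v \<and> fst u = fst v) (X \<union> Y) k)"
proof -
  let ?Y0 = "{j} \<times> {1..b}"
  let ?A = "common_nbr_sets (\<lambda>u v. u \<noteq> v \<and> fst u = fst v) (X \<union> Y) k"
  have fin: "finite X" "finite Y" "finite ?Y0" and cards: "card X = b" "card Y = c" "card ?Y0 = b"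
    by (auto simp: X_def Y_def)
  have A: "?A = {S. (S \<subset> X \<or> S \<subset> Y) \<and> card S = k}"
  proof (intro set_eqI iffI)
    fix S assume "S \<in> ?A"
    then obtain v where S: "S \<subseteq> X \<union> Y" "card S = k" "v \<in> X \<union> Y" "\<And>x. x \<in> S \<Longrightarrow> v \<noteq> x \<and> fst v = fst x"
      unfolding common_nbr_sets_def by blast
    have "S \<subset> X \<or> S \<subset> Y"
    proof (cases "v \<in> X")
      case True
      have "x \<in> X" if "x \<in> S" for x
        using S(4)[OF that] True S(1) that ij unfolding X_def Y_def by auto
      then show ?thesis using True S(4) by blast
    next
      case False
      then have "v \<in> Y" using S(3) by blast
      have "x \<in> Y" if "x \<in> S" for x
        using S(4)[OF that] \<open>v \<in> Y\<close> S(1) that ij unfolding X_def Y_def by auto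
      then show ?thesis using \<open>v \<in> Y\<close> S(4) by blast
    qed
    then show "S \<in> {S. (S \<subset> X \<or> S \<subset> Y) \<and> card S = k}" using S(2) by blast
  next
    fix S assume S: "S \<in> {S. (S \<subset> X \<or> S \<subset> Y) \<and> card S = k}"
    then obtain v where "(S \<subseteq> X \<and> v \<in> X \<or> S \<subseteq> Y \<and> v \<in> Y) \<and> v \<notin> S" by blast
    then have "\<forall>x\<in>S. v \<noteq> x \<and> fst v = fst x" "v \<in> X \<union> Y" "S \<subseteq> X \<union> Y"
      unfolding X_def Y_def by auto
    then show "S \<in> ?A" using S unfolding common_nbr_sets_def by blast
  qed
  \<comment> \<open>For \<open>c = b + 1\<close> the set \<open>{i} \<times> {1..c}\<close> sticks
    out of \<open>X\<close>: the last vertex of \<open>Y\<close> is adjacent to all of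
    \<open>X\<close>.\<close>
  have B: "common_nbr_sets (swap_adj i j) (X \<union> Y) k
      = {S. (S \<subseteq> X \<and> \<not> {i} \<times> {1..c} \<subseteq> S \<or> S \<subseteq> Y \<and> \<not> ?Y0 \<subseteq> S) \<and> card S = k}" (is "?B = _")
  proof (intro set_eqI iffI)
    fix S assume "S \<in> ?B"
    then obtain v where S: "S \<subseteq> X \<union> Y" "card S = k" "v \<in> X \<union> Y" "\<forall>x\<in>S. swap_adj i j v x"
      by (auto simp: common_nbr_sets_def)
    have "S \<subseteq> X \<and> \<not> {i} \<times> {1..c} \<subseteq> S \<or> S \<subseteq> Y \<and> \<not> ?Y0 \<subseteq> S"
    proof (cases "v \<in> X")
      case True
      then obtain l where v: "v = (i, l)" "l \<in> {1..b}" unfolding X_def by blast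
      have "S \<subseteq> Y" "(j, l) \<notin> S"
        using S(1,4) ij v unfolding X_def Y_def swap_adj_def by fastforce+
      then show ?thesis using v by blast
    next
      case False
      then obtain l where v: "v = (j, l)" "l \<in> {1..c}" using S(3) unfolding Y_def by blast
      have "S \<subseteq> X" "(i, l) \<notin> S"
        using S(1,4) ij v unfolding X_def Y_def swap_adj_def by fastforce+
      then show ?thesis using v by blast
    qed
    then show "S \<in> {S. (S \<subseteq> X \<and> \<not> {i} \<times> {1..c} \<subseteq> S \<or> S \<subseteq> Y \<and> \<not> ?Y0 \<subseteq> S) \<and> card S = k}"
      using S(2) by blast
  next
    fix S assume S: "S \<in> {S. (S \<subseteq> X \<and> \<not> {i} \<times> {1..c} \<subseteq> S \<or> S \<subseteq> Y \<and> \<not> ?Y0 \<subseteq> S) \<and> card S = k}"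
    then consider l where "S \<subseteq> X" "l \<in> {1..c}" "(i, l) \<notin> S" | l where "S \<subseteq> Y" "l \<in> {1..b}" "(j, l) \<notin> S"
      by blast
    then have "\<exists>v\<in>X \<union> Y. \<forall>x\<in>S. swap_adj i j v x"
    proof cases
      case (1 l)
      then have "(j, l) \<in> X \<union> Y" "\<forall>x\<in>S. swap_adj i j (j, l) x"
        unfolding X_def Y_def swap_adj_def by auto
      then show ?thesis by blast
    next
      case (2 l)
      then have "(i, l) \<in> X \<union> Y" "\<forall>x\<in>S. swap_adj i j (i, l) x"
        unfolding X_def Y_def swap_adj_def by auto
      then show ?thesis by blast
    qed
    then show "S \<in> ?B" using S unfolding common_nbr_sets_def by blast
  qed
  consider "c = b" | "c = b + 1" using le by linarith
  then show ?thesis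
  proof cases
    case 1
    have "{i} \<times> {1..c} = X" "?Y0 = Y" using 1 by (auto simp: X_def Y_def)
    then have "?B = ?A" unfolding A B by auto
    then show ?thesis by simp
  next
    case 2
    \<comment> \<open>For \<open>k = b\<close> the families differ in one set only: \<open>X\<close> replaces \<open>?Y0\<close>.\<close>
    let ?g = "\<lambda>S. if S = ?Y0 then X else S"
    have Y0: "?Y0 \<subset> Y"
    proof -
      have "?Y0 \<subseteq> Y" using le by (auto simp: Y_def)
      moreover have "?Y0 \<noteq> Y" using 2 cards by auto
      ultimately show ?thesis by blast
    qed
    have nX: "\<not> {i} \<times> {1..c} \<subseteq> S" if "S \<subseteq> X" for S
      using 2 that by (fastforce simp: X_def)
    \<comment> \<open>\<open>Y\<close> has just one element more than \<open>?Y0\<close>, so no set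
      lies strictly between them.\<close>
    have btw: "S = ?Y0 \<or> S = Y" if "?Y0 \<subseteq> S" "S \<subseteq> Y" for S
    proof -
      have "card S \<le> b + 1" "b \<le> card S"
        using that cards fin 2 card_mono[of Y S] card_mono[of S ?Y0] finite_subset[of S Y] by auto
      then consider "card S = card ?Y0" | "card S = card Y" using cards 2 by linarith
      then show ?thesis
        using card_subset_eq[of S ?Y0] card_subset_eq[of Y S] that fin finite_subset[of S Y] by cases auto
    qed
    have disj: "X \<inter> Y = {}" using ij unfolding X_def Y_def by blast
    have img: "?B = ?g ` ?A"
    proof (intro set_eqI iffI)
      fix S assume S: "S \<in> ?B"
      show "S \<in> ?g ` ?A"
      proof (cases "S = X")
        case True
        then have "k = b" using S cards unfolding B by simp
        then have "?Y0 \<in> ?A" unfolding A using Y0 cards by blast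
        then show ?thesis using True by (intro image_eqI[of _ _ ?Y0]) auto
      next
        case False
        have "S \<noteq> {}" using S k unfolding B by auto
        then have "S \<noteq> ?Y0" using S Y0 disj unfolding B by blast
        moreover have "S \<in> ?A" using S False Y0 unfolding A B by blast
        ultimately have "S \<in> ?A" "S \<noteq> ?Y0" by blast+
        then show ?thesis by (intro image_eqI[of _ _ S]) auto
      qed
    next
      fix S assume "S \<in> ?g ` ?A"
      then obtain T where T: "T \<in> ?A" "S = ?g T" by blast
      show "S \<in> ?B"
      proof (cases "T = ?Y0")
        case True
        then have "S = X" "card X = k" using T cards unfolding A by simp_all
        then show ?thesis using nX[of X] unfolding B by blast
      next
        case False
        then have "S = T" using T(2) by simp
        then show ?thesis using T(1) nX[of T] btw[of T] False unfolding A B by blast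
      qed
    qed
    have "inj_on ?g ?A"
    proof -
      \<comment> \<open>\<open>X\<close> is not a proper subset of itself, and by disjointness it
        lies in \<open>Y\<close> only if empty, which \<open>k \<ge> 1\<close> excludes.\<close>
      have "X \<notin> ?A"
      proof
        assume "X \<in> ?A"
        then have "X \<subseteq> Y" "card X = k" unfolding A by blast+
        then show False using disj k by (simp add: Int_absorb2)
      qed
      then have "S = T" if "S \<in> ?A" "T \<in> ?A" "?g S = ?g T" for S T
        using that by (cases "S = ?Y0"; cases "T = ?Y0") simp_all
      then show ?thesis by (intro inj_onI)
    qed
    then show ?thesis unfolding img by (rule card_image)
  qed
qed

lemma not_D_unique_complete_multipartite:
  assumes ij: "i \<in> {1..r}" "j \<in> {1..r}" "i \<noteq> j"
    and le: "a i \<le> a j" "a j \<le> a i + 1" "a j \<ge> 3"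
  shows "\<not> D_unique (complete_multipartite r a)"
proof
  assume D: "D_unique (complete_multipartite r a)"
  let ?K = "complete_multipartite r a"
  define V where "V = pverts ?K"
  define E where "E = swap_adj i j"
  \<comment> \<open>The complement of \<open>E\<close>: the classes \<open>i\<close> and
    \<open>j\<close> are rewired, the others remain cliques in the complement.\<close>
  define H :: "(nat \<times> nat) pair_pre_digraph" where
    "H = \<lparr> pverts = V, parcs = {(u, v). u \<in> V \<and> v \<in> V \<and> u \<noteq> v \<and> \<not> E u v} \<rparr>"
  have finV: "finite V" by (simp add: V_def pverts_complete_multipartite)
  have sym: "E u v \<longleftrightarrow> E v u" for u v
    unfolding E_def swap_adj_def by (auto simp: insert_commute)
  have irr: "\<not> E u u" for u
    unfolding E_def swap_adj_def by auto
  have "finite {(u, v). u \<in> V \<and> v \<in> V \<and> u \<noteq> v \<and> \<not> E u v}"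
    by (rule finite_subset[of _ "V \<times> V"]) (auto simp: finV)
  then have H: "pair_graph H"
    using sym finV
    by unfold_locales (auto simp: H_def symmetric_def arcs_ends_conv sym_def with_proj_def image_iff)
  interpret H: pair_graph H by (rule H)
  have vH: "pverts H = V" by (simp add: H_def)
  have coH: "co_adj H u v = E u v" if "u \<in> V" "v \<in> V" for u v
    using that irr[of u] by (cases "u = v") (simp_all add: co_adj_def H_def)
  let ?F = "\<lambda>u v :: nat \<times> nat. u \<noteq> v \<and> fst u = fst v"
  have coK: "co_adj ?K u v = ?F u v" if "u \<in> V" "v \<in> V" for u v
    using that by (auto simp: V_def co_adj_complete_multipartite)
  let ?W = "{i} \<times> {1..a i} \<union> {j} \<times> {1..a j}"
  have WV: "?W \<subseteq> V" using ij by (auto simp: V_def pverts_complete_multipartite)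
  have W: "v \<in> ?W \<longleftrightarrow> fst v \<in> {i, j}" if "v \<in> V" for v
    using that by (auto simp: V_def pverts_complete_multipartite)
  have "card (common_nbr_sets (co_adj H) V k) = card (common_nbr_sets (co_adj ?K) V k)" if k: "k \<ge> 1" for k
  proof -
    have "card (common_nbr_sets (co_adj H) V k) = card (common_nbr_sets E V k)"
      using common_nbr_sets_cong[of V "co_adj H" E k] coH by simp
    also have "\<dots> = card (common_nbr_sets E ?W k) + card (common_nbr_sets E (V - ?W) k)"
    proof (rule card_common_nbr_sets_split[OF finV WV k])
      fix x y assume "x \<in> ?W" "y \<in> V - ?W"
      then have "fst x \<in> {i, j}" "fst y \<notin> {i, j}" using W WV by blast+
      then show "\<not> E x y \<and> \<not> E y x" by (auto simp: E_def swap_adj_def)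
    qed
    also have "card (common_nbr_sets E ?W k) = card (common_nbr_sets ?F ?W k)"
      unfolding E_def using ij le k by (intro card_common_nbr_sets_swap) auto
    also have "common_nbr_sets E (V - ?W) k = common_nbr_sets ?F (V - ?W) k"
    proof (rule common_nbr_sets_cong)
      fix x y assume "x \<in> V - ?W" "y \<in> V - ?W"
      then have "fst x \<notin> {i, j}" "fst y \<notin> {i, j}" using W by blast+
      then show "E x y = ?F x y" by (simp add: E_def swap_adj_def)
    qed
    also have "card (common_nbr_sets ?F ?W k) + card (common_nbr_sets ?F (V - ?W) k) = card (common_nbr_sets ?F V k)"
    proof (rule card_common_nbr_sets_split[OF finV WV k, symmetric])
      fix x y assume "x \<in> ?W" "y \<in> V - ?W"
      then have "fst x \<in> {i, j}" "fst y \<notin> {i, j}" using W WV by blast+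
      then show "\<not> ?F x y \<and> \<not> ?F y x" by auto
    qed
    also have "\<dots> = card (common_nbr_sets (co_adj ?K) V k)"
      using common_nbr_sets_cong[of V "co_adj ?K" ?F k] coK by simp
    finally show ?thesis .
  qed
  then have "domination_poly H = domination_poly ?K"
    unfolding domination_poly_eq_iff[OF H pair_graph_complete_multipartite] vH V_def by simp
  then have "digraph_iso (with_proj H) (with_proj ?K)"
    by (rule D_uniqueD[OF D H])
  then have "\<exists>f. bij_betw f (pverts H) (pverts ?K) \<and>
      (\<forall>u\<in>pverts H. \<forall>v\<in>pverts H. co_adj H u v \<longleftrightarrow> co_adj ?K (f u) (f v))"
    by (rule digraph_iso_co_adj[OF H.pair_wf_digraph])
  then obtain f where f: "bij_betw f V (pverts ?K)"
      "\<And>u v. u \<in> V \<Longrightarrow> v \<in> V \<Longrightarrow> co_adj H u v \<longleftrightarrow> co_adj ?K (f u) (f v)"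
    unfolding vH by blast
  \<comment> \<open>An isomorphism would transport transitivity on distinct vertices from the
    cliques of the complement of \<open>?K\<close> back to \<open>E\<close>.\<close>
  have trans: "E u w" if "E u v" "E v w" "u \<in> V" "v \<in> V" "w \<in> V" "u \<noteq> w" for u v w
  proof -
    have fV: "f x \<in> V" if "x \<in> V" for x using bij_betw_apply[OF f(1) that] by (simp add: V_def)
    have "f u \<noteq> f w" using f(1) that by (auto simp: bij_betw_def inj_on_def)
    then show ?thesis
      using that f(2)[of u v] f(2)[of v w] f(2)[of u w] coH coK fV by auto
  qed
  \<comment> \<open>The sizes are at least 2 and 3, so \<open>(j, 3)\<close> is a common neighbor of
    \<open>(i, 1)\<close> and \<open>(i, 2)\<close>, which lie in the same class and are not
    adjacent under \<open>E\<close>.\<close>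
  have "(i, 1) \<in> V" "(j, 3) \<in> V" "(i, 2) \<in> V"
    using ij le by (auto simp: V_def pverts_complete_multipartite)
  then have "E (i, 1) (i, 2)"
    by (rule trans[of "(i, 1)" "(j, 3)" "(i, 2)", rotated 2]) (auto simp: E_def swap_adj_def)
  then show False using ij(3) by (auto simp: E_def swap_adj_def doubleton_eq_iff)
qed

theorem theorem1p4:
  fixes r :: nat and a :: "nat \<Rightarrow> nat"
  assumes "r \<ge> 1"
    and "\<And>i. 1 \<le> i \<Longrightarrow> i \<le> r \<Longrightarrow> a i \<ge> 1"
  shows "D_unique (complete_multipartite r a) \<longleftrightarrow>
    (\<forall>i j. 1 \<le> i \<and> i < j \<and> j \<le> r \<longrightarrow>
       max (a i) (a j) \<le> 2 \<or> \<bar>int (a i) - int (a j)\<bar> \<ge> 2)"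
    (is "_ \<longleftrightarrow> ?gap")
proof
  assume D: "D_unique (complete_multipartite r a)"
  show ?gap
  proof (intro allI impI, rule ccontr)
    fix i j assume ij: "1 \<le> i \<and> i < j \<and> j \<le> r"
      and "\<not> (max (a i) (a j) \<le> 2 \<or> \<bar>int (a i) - int (a j)\<bar> \<ge> 2)"
    then consider "a i \<le> a j" "a j \<le> a i + 1" "a j \<ge> 3" | "a j \<le> a i" "a i \<le> a j + 1" "a i \<ge> 3"
      by linarith
    then show False
      using not_D_unique_complete_multipartite[of i r j a] not_D_unique_complete_multipartite[of j r i a] D ij
      by cases auto
  qed
next
  assume gap: ?gap
  let ?K = "complete_multipartite r a"
  \<comment> \<open>The induction orders the two classes by size rather than by index.\<close>
  have gap': "a i \<le> 2 \<or> a j + 2 \<le> a i"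
    if "i \<in> {1..r}" "j \<in> {1..r}" "i \<noteq> j" "a j \<le> a i" for i j
  proof (cases "i < j")
    case True
    then have "max (a i) (a j) \<le> 2 \<or> \<bar>int (a i) - int (a j)\<bar> \<ge> 2" using gap[rule_format, of i j] that by simp
    then show ?thesis using that by linarith
  next
    case False
    then have "max (a j) (a i) \<le> 2 \<or> \<bar>int (a j) - int (a i)\<bar> \<ge> 2"
      using gap[rule_format, of j i] that by simp
    then show ?thesis using that by linarith
  qed
  show "D_unique ?K"
    unfolding D_unique_def
  proof (intro allI impI)
    fix H :: "nat pair_pre_digraph"
    assume H: "pair_graph H" and eq: "domination_poly H = domination_poly ?K"
    interpret H: pair_graph H by fact
    have finK: "finite (pverts ?K)" by (simp add: pverts_complete_multipartite)
    have n: "card (pverts H) = card (pverts ?K)"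
      and c: "\<And>k. k \<ge> 1 \<Longrightarrow> card (common_nbr_sets (co_adj H) (pverts H) k)
        = card (common_nbr_sets (co_adj ?K) (pverts ?K) k)"
      using eq unfolding domination_poly_eq_iff[OF H pair_graph_complete_multipartite] by blast+
    have "\<exists>c. clique_partition (co_adj H) (pverts H) {1..r} a c"
    proof (rule clique_partition_of_counts[OF H.pair_finite_verts H.symp_co_adj irreflp_co_adj])
      show "card (pverts H) = (\<Sum>j\<in>{1..r}. a j)"
        unfolding n by (simp add: pverts_complete_multipartite)
      show "card (common_nbr_sets (co_adj H) (pverts H) k)
          = (\<Sum>j\<in>{1..r}. if k = a j then 0 else a j choose k)" if "k \<ge> 1" for k
        unfolding c[OF that]
        by (rule card_common_nbr_sets_clique_partition[OF finK _ clique_partition_complete_multipartite that]) simp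
    qed (use gap' assms in auto)
    then show "digraph_iso (with_proj H) (with_proj ?K)"
      using digraph_iso_complete_multipartite[OF H] by blast
  qed
qed

end
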